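(* Suppose $f:X\to Y$ and $g:Y\to Z$ are maps of non-empty, path-connected spaces. (1) If $f$ and $g$ have the continuous path-covering property, then so does $g\circ f$. (2) If $g$ and $g\circ f$ have the continuous path-covering property, then so does $f$. (3) If $g$ is surjective and $f$ and $g\circ f$ have the continuous path-covering property, then so does $g$. Moreover, the statements (1)–(3) hold if "continuous path-covering property" is replaced throughout by "path-covering property".
   Context: Maps are continuous. $P(Y,y)$ is the space of paths $\alpha:[0,1]\to Y$ with $\alpha(0)=y$, with the compact-open topology. A map $p:E\to X$ has the path-covering property (resp. continuous path-covering property) if for every $e\in E$ the induced map $P(p):P(E,e)\to P(X,p(e))$, $\alpha\mapsto p\circ\alpha$, is a bijection (resp. a homeomorphism). *)

theory Defs
  imports "HOL-Analysis.Analysis"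
begin

(* Maps are represented by functions that are extensional on the topspace of the domain,
   so that equality of functions is equality of maps. The sets given below form a subbase
   (the choice K = {} gives all maps). *)
definition compact_open_topology ::
    "'a topology \<Rightarrow> 'b topology \<Rightarrow> ('a \<Rightarrow> 'b) topology" where
  "compact_open_topology X Y =
     topology_generated_by
       {{f \<in> extensional (topspace X). continuous_map X Y f \<and> f ` K \<subseteq> U} | K U.
          compactin X K \<and> openin Y U}"

lemma topspace_compact_open_topology:
  "topspace (compact_open_topology X Y) = {f \<in> extensional (topspace X). continuous_map X Y f}"
proof -
  have "\<exists>K U. compactin X K \<and> openin Y U \<and> f ` K \<subseteq> U" for f :: "'a \<Rightarrow> 'b"
    using compactin_empty openin_empty by blast
  then show ?thesis
    unfolding compact_open_topology_def topology_generated_by_topspace by blast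
qed

definition path_space :: "'a topology \<Rightarrow> 'a \<Rightarrow> (real \<Rightarrow> 'a) topology" where
  "path_space Y y =
     subtopology (compact_open_topology (top_of_set {0..1}) Y) {\<alpha>. \<alpha> 0 = y}"

lemma topspace_path_space:
  "topspace (path_space Y y) = {\<alpha> \<in> extensional {0..1}. pathin Y \<alpha> \<and> \<alpha> 0 = y}"
  by (auto simp: path_space_def topspace_compact_open_topology pathin_def)

definition path_map :: "('a \<Rightarrow> 'b) \<Rightarrow> (real \<Rightarrow> 'a) \<Rightarrow> (real \<Rightarrow> 'b)" where
  "path_map p \<alpha> = restrict (p \<circ> \<alpha>) {0..1}"

definition path_covering_property ::
    "'a topology \<Rightarrow> 'b topology \<Rightarrow> ('a \<Rightarrow> 'b) \<Rightarrow> bool" where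
  "path_covering_property E X p \<longleftrightarrow>
     continuous_map E X p \<and>
     (\<forall>e \<in> topspace E. bij_betw (path_map p)
        (topspace (path_space E e)) (topspace (path_space X (p e))))"

definition continuous_path_covering_property ::
    "'a topology \<Rightarrow> 'b topology \<Rightarrow> ('a \<Rightarrow> 'b) \<Rightarrow> bool" where
  "continuous_path_covering_property E X p \<longleftrightarrow>
     continuous_map E X p \<and>
     (\<forall>e \<in> topspace E. homeomorphic_map (path_space E e) (path_space X (p e)) (path_map p))"

end

(* On path spaces the assignment p |-> path_map p is functorial, so each claim is two-out-of-three
   for bijections or for homeomorphisms. The base point is what needs care in (3): a base point of Y
   must be hit by f, which follows by lifting a path in Y that ends at it. *)

theory Submission
  imports Defs
begin

text \<open>Cancellation on the right: an inverse \<open>f'\<close> of \<open>f\<close> gives back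
  \<open>g\<close> as \<open>(g \<circ> f) \<circ> f'\<close>. The two agree on the points of
  \<open>B\<close>, and a homeomorphism depends on nothing else.\<close>

lemma homeomorphic_map_comp_iff:
  assumes "homeomorphic_map A B f"
  shows "homeomorphic_map B C g \<longleftrightarrow> homeomorphic_map A C (g \<circ> f)"
proof
  assume "homeomorphic_map A C (g \<circ> f)"
  moreover obtain f' where f': "homeomorphic_maps A B f f'"
    using assms homeomorphic_map_maps by blast
  ultimately have "homeomorphic_map B C ((g \<circ> f) \<circ> f')"
    by (meson homeomorphic_map_compose homeomorphic_maps_map)
  then show "homeomorphic_map B C g"
    by (rule homeomorphic_map_eq) (use f' in \<open>simp add: homeomorphic_maps_map\<close>)
qed (use assms homeomorphic_map_compose in blast)

text \<open>Cancellation on the left, by composing with an inverse \<open>g'\<close> of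
  \<open>g\<close>. Since \<open>g'\<close> undoes \<open>g\<close> only on points of
  \<open>B\<close>, the values of \<open>f\<close> must be known to lie there.\<close>

lemma homeomorphic_map_comp_iff2:
  assumes "homeomorphic_map B C g" and f: "f \<in> topspace A \<rightarrow> topspace B"
  shows "homeomorphic_map A B f \<longleftrightarrow> homeomorphic_map A C (g \<circ> f)"
proof
  assume "homeomorphic_map A C (g \<circ> f)"
  moreover obtain g' where g': "homeomorphic_maps B C g g'"
    using assms homeomorphic_map_maps by blast
  ultimately have "homeomorphic_map A B (g' \<circ> (g \<circ> f))"
    by (meson homeomorphic_map_compose homeomorphic_maps_map)
  then show "homeomorphic_map A B f"
    by (rule homeomorphic_map_eq) (use f g' in \<open>auto simp: homeomorphic_maps_map\<close>)
qed (use assms homeomorphic_map_compose in blast)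

lemma path_map_in_path_space:
  assumes "continuous_map X Y p"
  shows "path_map p \<in> topspace (path_space X x) \<rightarrow> topspace (path_space Y (p x))"
proof
  fix \<alpha> assume "\<alpha> \<in> topspace (path_space X x)"
  then have "pathin X \<alpha>" "\<alpha> 0 = x"
    by (auto simp: topspace_path_space)
  moreover from this have "pathin Y (p \<circ> \<alpha>)"
    using assms pathin_compose by blast
  \<comment> \<open>Restricting changes values only outside the unit interval, where continuity of a
    path is not tested.\<close>
  then have "pathin Y (path_map p \<alpha>)"
    unfolding pathin_def path_map_def by (rule continuous_map_eq) simp
  ultimately show "path_map p \<alpha> \<in> topspace (path_space Y (p x))"
    by (simp add: topspace_path_space path_map_def)
qed

text \<open>The functoriality is a true equation of functions: the outer restriction hides the
  default values that the inner one introduces off the unit interval.\<close>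

lemma path_map_comp: "path_map (g \<circ> f) = path_map g \<circ> path_map f"
  by (auto simp: path_map_def fun_eq_iff restrict_def)

lemma continuous_path_covering_property_imp:
  assumes "continuous_path_covering_property E X p"
  shows "path_covering_property E X p"
  using assms
  unfolding continuous_path_covering_property_def path_covering_property_def bij_betw_def
  by (metis homeomorphic_imp_injective_map homeomorphic_imp_surjective_map)

text \<open>The lift at \<open>e\<close> of a path from \<open>p e\<close> to \<open>x\<close> ends
  at a point over \<open>x\<close>.\<close>

lemma path_covering_property_imp_surj:
  assumes p: "path_covering_property E X p"
    and "topspace E \<noteq> {}" and X: "path_connected_space X"
  shows "p ` topspace E = topspace X"
proof
  have cont: "continuous_map E X p"
    using p by (simp add: path_covering_property_def)
  then show "p ` topspace E \<subseteq> topspace X"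
    by (rule continuous_map_image_subset_topspace)
  obtain e where e: "e \<in> topspace E"
    using assms(2) by blast
  show "topspace X \<subseteq> p ` topspace E"
  proof
    fix x assume "x \<in> topspace X"
    moreover have "p e \<in> topspace X"
      using cont e continuous_map_image_subset_topspace by blast
    ultimately obtain \<beta> where \<beta>: "pathin X \<beta>" "\<beta> 0 = p e" "\<beta> 1 = x"
      using X unfolding path_connected_space_def by blast
    \<comment> \<open>Points of the path space are extensional, so the path must be normalised
      before it can be lifted.\<close>
    have "pathin X (restrict \<beta> {0..1})"
      using \<beta>(1) unfolding pathin_def by (rule continuous_map_eq) simp
    with \<beta> have "restrict \<beta> {0..1} \<in> topspace (path_space X (p e))"
      by (simp add: topspace_path_space)
    then obtain \<alpha> where \<alpha>: "\<alpha> \<in> topspace (path_space E e)" "path_map p \<alpha> = restrict \<beta> {0..1}"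
      using p e unfolding path_covering_property_def bij_betw_def by (metis imageE)
    \<comment> \<open>At 1 both restrictions are transparent, so the equation of paths yields one of
      endpoints.\<close>
    have "p (\<alpha> 1) = x"
      using fun_cong [OF \<alpha>(2), of 1] \<beta>(3) by (simp add: path_map_def)
    moreover have "\<alpha> 1 \<in> topspace E"
      using \<alpha>(1) by (auto simp: topspace_path_space pathin_def continuous_map_def)
    ultimately show "x \<in> p ` topspace E"
      by blast
  qed
qed

text \<open>At a base point \<open>f x\<close> the bijection \<open>path_map f\<close> can be
  cancelled on the right. Surjectivity of \<open>f\<close> ensures that every base point of
  \<open>Y\<close> has this form.\<close>

lemma path_covering_property_comp_iff:
  assumes f: "path_covering_property X Y f" and surj: "f ` topspace X = topspace Y"
    and g: "continuous_map Y Z g"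
  shows "path_covering_property Y Z g \<longleftrightarrow> path_covering_property X Z (g \<circ> f)"
proof -
  have "bij_betw (path_map g)
          (topspace (path_space Y (f x))) (topspace (path_space Z (g (f x)))) \<longleftrightarrow>
        bij_betw (path_map (g \<circ> f))
          (topspace (path_space X x)) (topspace (path_space Z (g (f x))))"
    if "x \<in> topspace X" for x
    unfolding path_map_comp
    by (rule bij_betw_comp_iff) (use f that in \<open>simp add: path_covering_property_def\<close>)
  moreover have "continuous_map X Z (g \<circ> f)"
    using f g continuous_map_compose unfolding path_covering_property_def by blast
  ultimately show ?thesis
    \<comment> \<open>Writing \<open>topspace Y\<close> as the image of \<open>f\<close> turns the
      quantifier over base points of \<open>Y\<close> into one over \<open>X\<close>.\<close>
    using g unfolding path_covering_property_def surj [symmetric] by auto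
qed

text \<open>Both sides range over base points \<open>x\<close> of \<open>X\<close>, and the
  bijection \<open>path_map g\<close> at \<open>f x\<close> can be cancelled on the left.\<close>

lemma path_covering_property_comp_iff2:
  assumes g: "path_covering_property Y Z g" and f: "continuous_map X Y f"
  shows "path_covering_property X Y f \<longleftrightarrow> path_covering_property X Z (g \<circ> f)"
proof -
  have "bij_betw (path_map f)
          (topspace (path_space X x)) (topspace (path_space Y (f x))) \<longleftrightarrow>
        bij_betw (path_map (g \<circ> f))
          (topspace (path_space X x)) (topspace (path_space Z (g (f x))))"
    if "x \<in> topspace X" for x
  proof -
    have "f x \<in> topspace Y"
      using f that continuous_map_image_subset_topspace by blast
    with g have "bij_betw (path_map g)
          (topspace (path_space Y (f x))) (topspace (path_space Z (g (f x))))"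
      by (simp add: path_covering_property_def)
    then show ?thesis
      unfolding path_map_comp
      by (rule bij_betw_comp_iff2) (use path_map_in_path_space [OF f] in blast)
  qed
  moreover have "continuous_map X Z (g \<circ> f)"
    using f g continuous_map_compose unfolding path_covering_property_def by blast
  ultimately show ?thesis
    using f unfolding path_covering_property_def by auto
qed

text \<open>The argument for bijections carries over, with cancellation of homeomorphisms in place
  of cancellation of bijections.\<close>

lemma continuous_path_covering_property_comp_iff:
  assumes f: "continuous_path_covering_property X Y f" and surj: "f ` topspace X = topspace Y"
    and g: "continuous_map Y Z g"
  shows "continuous_path_covering_property Y Z g \<longleftrightarrow>
    continuous_path_covering_property X Z (g \<circ> f)"
proof -
  have "homeomorphic_map (path_space Y (f x)) (path_space Z (g (f x))) (path_map g) \<longleftrightarrow>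
        homeomorphic_map (path_space X x) (path_space Z (g (f x))) (path_map (g \<circ> f))"
    if "x \<in> topspace X" for x
    unfolding path_map_comp
    by (rule homeomorphic_map_comp_iff)
       (use f that in \<open>simp add: continuous_path_covering_property_def\<close>)
  moreover have "continuous_map X Z (g \<circ> f)"
    using f g continuous_map_compose unfolding continuous_path_covering_property_def by blast
  ultimately show ?thesis
    using g unfolding continuous_path_covering_property_def surj [symmetric] by auto
qed

lemma continuous_path_covering_property_comp_iff2:
  assumes g: "continuous_path_covering_property Y Z g" and f: "continuous_map X Y f"
  shows "continuous_path_covering_property X Y f \<longleftrightarrow>
    continuous_path_covering_property X Z (g \<circ> f)"
proof -
  have "homeomorphic_map (path_space X x) (path_space Y (f x)) (path_map f) \<longleftrightarrow>
        homeomorphic_map (path_space X x) (path_space Z (g (f x))) (path_map (g \<circ> f))"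
    if "x \<in> topspace X" for x
  proof -
    have "f x \<in> topspace Y"
      using f that continuous_map_image_subset_topspace by blast
    with g have "homeomorphic_map (path_space Y (f x)) (path_space Z (g (f x))) (path_map g)"
      by (simp add: continuous_path_covering_property_def)
    then show ?thesis
      unfolding path_map_comp
      by (rule homeomorphic_map_comp_iff2) (rule path_map_in_path_space [OF f])
  qed
  moreover have "continuous_map X Z (g \<circ> f)"
    using f g continuous_map_compose unfolding continuous_path_covering_property_def by blast
  ultimately show ?thesis
    using f unfolding continuous_path_covering_property_def by auto
qed

theorem lemma3p5:
  fixes X :: "'a topology" and Y :: "'b topology" and Z :: "'c topology"
    and f :: "'a \<Rightarrow> 'b" and g :: "'b \<Rightarrow> 'c"
  assumes "topspace X \<noteq> {}" and "topspace Y \<noteq> {}" and "topspace Z \<noteq> {}"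
    and "path_connected_space X" and "path_connected_space Y" and "path_connected_space Z"
    and "continuous_map X Y f" and "continuous_map Y Z g"
  shows
    "(continuous_path_covering_property X Y f \<and> continuous_path_covering_property Y Z g
        \<longrightarrow> continuous_path_covering_property X Z (g \<circ> f)) \<and>
     (continuous_path_covering_property Y Z g \<and> continuous_path_covering_property X Z (g \<circ> f)
        \<longrightarrow> continuous_path_covering_property X Y f) \<and>
     (g ` topspace Y = topspace Z \<and>
      continuous_path_covering_property X Y f \<and> continuous_path_covering_property X Z (g \<circ> f)
        \<longrightarrow> continuous_path_covering_property Y Z g) \<and>
     (path_covering_property X Y f \<and> path_covering_property Y Z g
        \<longrightarrow> path_covering_property X Z (g \<circ> f)) \<and>
     (path_covering_property Y Z g \<and> path_covering_property X Z (g \<circ> f)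
        \<longrightarrow> path_covering_property X Y f) \<and>
     (g ` topspace Y = topspace Z \<and>
      path_covering_property X Y f \<and> path_covering_property X Z (g \<circ> f)
        \<longrightarrow> path_covering_property Y Z g)"
proof -
  \<comment> \<open>This serves both versions of (3), because the continuous property implies the
    plain one.\<close>
  have surj: "f ` topspace X = topspace Y" if "path_covering_property X Y f"
    using that assms(1,5) by (rule path_covering_property_imp_surj)
  \<comment> \<open>In either version, (1) and (2) are the two directions of the left cancellation
    law, and (3) is the backward direction of the right one; what remains is propositional.\<close>
  show ?thesis
    using assms(7,8) surj continuous_path_covering_property_imp [of X Y f]
      path_covering_property_comp_iff [of X Y f Z g]
      path_covering_property_comp_iff2 [of Y Z g X f]
      continuous_path_covering_property_comp_iff [of X Y f Z g]
      continuous_path_covering_property_comp_iff2 [of Y Z g X f]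
    by argo
qed

end
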